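(* Consider a system of two qubits $S$ and $A$ ($n_S=n_A=2$), and assume that $S+A$ is completely controllable (CC), i.e. every $X\in SU(4)$ is attainable as a unitary evolution of $S+A$. Then $S$ is pure fully indirectly controllable (pure FIC): for all $2\times2$ density matrices $\rho_S$ and $\rho_S'$ there exist a pure state $\rho_A$ of $A$ and an attainable unitary $X\in SU(4)$ such that $$\mathrm{Tr}_A\bigl(X(\rho_S\otimes\rho_A)X^\dagger\bigr)=\rho_S'.$$
   Context: A density matrix is a Hermitian positive semidefinite matrix of trace $1$; a pure state is a rank-one density matrix $|\psi\rangle\langle\psi|$. $S$ is the first and $A$ the second factor of $\mathbb C^2\otimes\mathbb C^2$, and $\mathrm{Tr}_A$ is the linear map on $4\times 4$ matrices with $\mathrm{Tr}_A(P\otimes Q)=\mathrm{Tr}(Q)P$. Given a set $\Lambda_A$ of initial states of $A$, the reachable set from $\rho_S$ is the set of all $\mathrm{Tr}_A(X(\rho_S\otimes\rho_A)X^\dagger)$ with $\rho_A\in\Lambda_A$ and $X$ an attainable unitary evolution of $S+A$. $S$ is fully indirectly controllable (FIC) given $\Lambda_A$ if for every $\rho_S$ the reachable set is the set of all density matrices of $S$; it is pure FIC if this holds with $\Lambda_A$ the set of all pure states of $A$. *)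

theory Defs
  imports "HOL-Analysis.Analysis"
begin

definition conj_transpose :: "complex^'n^'m \<Rightarrow> complex^'m^'n" where
  "conj_transpose M = (\<chi> i j. cnj (M $ j $ i))"

definition hermitian :: "complex^'n^'n \<Rightarrow> bool" where
  "hermitian M \<longleftrightarrow> conj_transpose M = M"

(* For Hermitian M the quadratic form is real, so taking the real part loses nothing. *)
definition pos_semidef :: "complex^'n^'n \<Rightarrow> bool" where
  "pos_semidef M \<longleftrightarrow> hermitian M \<and> (\<forall>v. 0 \<le> Re (\<Sum>i\<in>UNIV. cnj (v $ i) * (M *v v) $ i))"

definition density_matrix :: "complex^'n^'n \<Rightarrow> bool" where
  "density_matrix \<rho> \<longleftrightarrow> pos_semidef \<rho> \<and> trace \<rho> = 1"

(* The library's rank is the dimension of the row space over the entry field, here the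
   complex numbers. *)
definition pure_state :: "complex^'n^'n \<Rightarrow> bool" where
  "pure_state \<rho> \<longleftrightarrow> density_matrix \<rho> \<and> rank \<rho> = 1"

definition unitary :: "complex^'n^'n \<Rightarrow> bool" where
  "unitary X \<longleftrightarrow> X ** conj_transpose X = mat 1 \<and> conj_transpose X ** X = mat 1"

definition special_unitary :: "(complex^'n^'n) set" where
  "special_unitary = {X. unitary X \<and> det X = 1}"

(* The tensor product of the spaces with index types 's and 'a has index type 's \<times> 'a; the
   first component belongs to S, the second to A. *)
definition kron ::
  "complex^('s::finite)^'s \<Rightarrow> complex^('a::finite)^'a \<Rightarrow> complex^('s \<times> 'a)^('s \<times> 'a)" where
  "kron P Q = (\<chi> i j. P $ fst i $ fst j * Q $ snd i $ snd j)"

definition partial_trace_A ::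
  "complex^('s::finite \<times> 'a::finite)^('s \<times> 'a) \<Rightarrow> complex^'s^'s" where
  "partial_trace_A M = (\<chi> i j. \<Sum>k\<in>UNIV. M $ (i, k) $ (j, k))"

lemma partial_trace_A_kron:
  "partial_trace_A (kron P Q) = (\<chi> i j. trace Q * P $ i $ j)"
  by (simp add: partial_trace_A_def kron_def trace_def vec_eq_iff sum_distrib_left mult.commute)

lemma partial_trace_A_add:
  "partial_trace_A (M + N) = partial_trace_A M + partial_trace_A N"
  by (simp add: partial_trace_A_def vec_eq_iff sum.distrib)

lemma partial_trace_A_scale:
  "partial_trace_A (\<chi> i j. c * M $ i $ j) = (\<chi> i j. c * partial_trace_A M $ i $ j)"
  by (simp add: partial_trace_A_def vec_eq_iff sum_distrib_left)

(* The parameter R is the set of attainable unitary evolutions of S + A. *)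
definition reachable_set ::
  "(complex^('s::finite \<times> 'a::finite)^('s \<times> 'a)) set \<Rightarrow> (complex^'a^'a) set
    \<Rightarrow> complex^'s^'s \<Rightarrow> (complex^'s^'s) set" where
  "reachable_set R \<Lambda> \<rho>\<^sub>S =
     {partial_trace_A (X ** kron \<rho>\<^sub>S \<rho>\<^sub>A ** conj_transpose X) | X \<rho>\<^sub>A. X \<in> R \<and> \<rho>\<^sub>A \<in> \<Lambda>}"

definition fully_indirectly_controllable ::
  "(complex^('s::finite \<times> 'a::finite)^('s \<times> 'a)) set \<Rightarrow> (complex^'a^'a) set \<Rightarrow> bool" where
  "fully_indirectly_controllable R \<Lambda> \<longleftrightarrow>
     (\<forall>\<rho>\<^sub>S. density_matrix \<rho>\<^sub>S \<longrightarrow> reachable_set R \<Lambda> \<rho>\<^sub>S = {\<rho>. density_matrix \<rho>})"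

definition pure_fully_indirectly_controllable ::
  "(complex^('s::finite \<times> 'a::finite)^('s \<times> 'a)) set \<Rightarrow> bool" where
  "pure_fully_indirectly_controllable R \<longleftrightarrow>
     fully_indirectly_controllable R {\<rho>\<^sub>A. pure_state \<rho>\<^sub>A}"

(* Containment rather than equality: R may also contain unitaries that differ from special
   ones by a phase. *)
definition completely_controllable ::
  "(complex^('s::finite \<times> 'a::finite)^('s \<times> 'a)) set \<Rightarrow> bool" where
  "completely_controllable R \<longleftrightarrow> special_unitary \<subseteq> R"

lemma pure_state_iff_outer_product:
  fixes \<rho> :: "complex^'n^'n"
  shows "pure_state \<rho> \<longleftrightarrow> (\<exists>\<psi>. norm \<psi> = 1 \<and> \<rho> = (\<chi> i j. \<psi> $ i * cnj (\<psi> $ j)))"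
proof
  assume p: "pure_state \<rho>"
  then have herm: "\<And>i j. cnj (\<rho> $ j $ i) = \<rho> $ i $ j"
    and tr: "(\<Sum>i\<in>UNIV. \<rho> $ i $ i) = 1" and rk: "vec.dim (rows \<rho>) = 1"
    and psd: "\<And>v. 0 \<le> Re (\<Sum>i\<in>UNIV. cnj (v $ i) * (\<rho> *v v) $ i)"
    by (auto simp: pure_state_def density_matrix_def pos_semidef_def hermitian_def
        conj_transpose_def trace_def vec_eq_iff row_rank_def_gen)
  obtain B where B: "rows \<rho> \<subseteq> vec.span B" "card B = vec.dim (rows \<rho>)"
    by (rule vec.basis_exists)
  then obtain v where "B = {v}" using rk card_1_singletonE by metis
  then have "\<forall>i. \<exists>c. row i \<rho> = c *s v"
    using B(1) by (auto simp: rows_def vec.span_singleton)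
  then obtain c where "\<And>i. row i \<rho> = c i *s v" by metis
  then have cv: "\<rho> $ i $ j = c i * v $ j" for i j by (simp add: row_def vec_eq_iff)
  obtain k where k: "\<rho> $ k $ k \<noteq> 0"
    using tr by (cases "\<forall>k. \<rho> $ k $ k = 0") auto
  have "(\<Sum>i\<in>UNIV. cnj (axis k 1 $ i) * (\<rho> *v axis k 1) $ i) = \<rho> $ k $ k"
    by (simp add: matrix_vector_mult_def axis_def if_distrib if_distribR cong: if_cong)
  then have pos: "0 \<le> Re (\<rho> $ k $ k)" using psd[of "axis k 1"] by simp
  have im: "Im (\<rho> $ k $ k) = 0" using herm[of k k] by (simp add: complex_eq_iff)
  define d where "d = sqrt (Re (\<rho> $ k $ k))"
  have dd: "of_real d * of_real d = \<rho> $ k $ k"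
    using pos im by (simp add: d_def complex_eq_iff)
  define \<psi> :: "complex^'n" where "\<psi> = (\<chi> i. \<rho> $ i $ k / of_real d)"
  have "\<psi> $ i * cnj (\<psi> $ j) = \<rho> $ i $ j" for i j
  proof -
    have "\<psi> $ i * cnj (\<psi> $ j) = \<rho> $ i $ k * \<rho> $ k $ j / \<rho> $ k $ k"
      using dd by (simp add: \<psi>_def herm)
    also have "\<dots> = \<rho> $ i $ j" using k by (simp add: cv field_simps)
    finally show ?thesis .
  qed
  then have eq: "\<rho> = (\<chi> i j. \<psi> $ i * cnj (\<psi> $ j))" by (simp add: vec_eq_iff)
  have "of_real (\<Sum>i\<in>UNIV. (cmod (\<psi> $ i))\<^sup>2) = (1::complex)"
    using tr by (subst (asm) eq) (simp add: complex_norm_square del: of_real_power)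
  then have "(\<Sum>i\<in>UNIV. (cmod (\<psi> $ i))\<^sup>2) = 1" using of_real_eq_1_iff by blast
  then have "norm \<psi> = 1" by (simp add: norm_vec_def L2_set_def)
  then show "\<exists>\<psi>. norm \<psi> = 1 \<and> \<rho> = (\<chi> i j. \<psi> $ i * cnj (\<psi> $ j))" using eq by blast
next
  assume "\<exists>\<psi>. norm \<psi> = 1 \<and> \<rho> = (\<chi> i j. \<psi> $ i * cnj (\<psi> $ j))"
  then obtain \<psi> where n: "norm \<psi> = 1" and eq: "\<rho> = (\<chi> i j. \<psi> $ i * cnj (\<psi> $ j))" by blast
  have n2: "(\<Sum>i\<in>UNIV. (cmod (\<psi> $ i))\<^sup>2) = 1" using n by (simp add: norm_vec_def L2_set_def)
  have tr: "trace \<rho> = 1"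
    using arg_cong[OF n2, of complex_of_real] by (simp add: eq trace_def complex_norm_square del: of_real_power)
  have herm: "hermitian \<rho>"
    by (simp add: eq hermitian_def conj_transpose_def vec_eq_iff mult.commute)
  have psd: "0 \<le> Re (\<Sum>i\<in>UNIV. cnj (v $ i) * (\<rho> *v v) $ i)" for v
  proof -
    define s where "s = (\<Sum>j\<in>UNIV. cnj (\<psi> $ j) * v $ j)"
    have "(\<rho> *v v) $ i = \<psi> $ i * s" for i
      by (simp add: eq s_def matrix_vector_mult_def sum_distrib_left mult.assoc)
    then have "(\<Sum>i\<in>UNIV. cnj (v $ i) * (\<rho> *v v) $ i) = cnj s * s"
      by (simp add: s_def cnj_sum sum_distrib_right mult.assoc mult.left_commute)
    then show ?thesis by (simp add: mult.commute)
  qed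
  define w :: "complex^'n" where "w = (\<chi> j. cnj (\<psi> $ j))"
  have rw: "row i \<rho> = \<psi> $ i *s w" for i by (simp add: eq row_def w_def vec_eq_iff)
  obtain k where k: "\<psi> $ k \<noteq> 0" using n by (cases "\<psi> = 0") (auto simp: vec_eq_iff)
  then have "w $ k \<noteq> 0" by (simp add: w_def)
  then have w0: "w \<noteq> 0" by auto
  have "vec.span (rows \<rho>) = vec.span {w}"
  proof (rule vec.span_eq[THEN iffD2], intro conjI subsetI)
    fix x assume "x \<in> rows \<rho>"
    then show "x \<in> vec.span {w}" by (auto simp: rows_def rw intro: vec.span_scale vec.span_base)
  next
    fix x assume "x \<in> {w}"
    then have "x = inverse (\<psi> $ k) *s row k \<rho>" using k by (simp add: rw vec_eq_iff)
    moreover have "row k \<rho> \<in> rows \<rho>" by (auto simp: rows_def)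
    ultimately show "x \<in> vec.span (rows \<rho>)"
      by (metis vec.span_scale vec.span_base)
  qed
  then have "vec.dim (rows \<rho>) = vec.dim {w}" using vec.span_eq_dim by blast
  also have "\<dots> = 1" using w0 by (simp add: vec.dim_eq_card_independent vec.independent_insert)
  finally show "pure_state \<rho>"
    using tr herm psd
    by (simp add: pure_state_def density_matrix_def pos_semidef_def row_rank_def_gen)
qed

end

theory Submission
  imports Defs
begin

text \<open>
  Diagonalize the source state as diag(p, 1 - p) and the target state as diag(q, 1 - q). With the
  ancilla in the first basis state, the joint state is a mixture, with weights p and 1 - p, of two
  orthogonal product vectors. Map these to the Schmidt vectors a |11> + b |22> and
  a |12> + b |21> with a = sqrt q, b = sqrt (1 - q): they are orthogonal, and both have
  reduced state diag(q, 1 - q), so the mixture has it as well, whatever p is. A global phase, which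
  cancels under conjugation, makes the determinant equal to 1. Conversely, every reachable matrix
  is a density matrix, since isometric conjugation and the partial trace preserve this property.
\<close>

section \<open>Adjoints, scalar matrices and unitaries\<close>

lemma conj_transpose_mult:
  fixes M :: "complex^'n^'m" and N :: "complex^'k^'n"
  shows "conj_transpose (M ** N) = conj_transpose N ** conj_transpose M"
  by (simp add: conj_transpose_def matrix_matrix_mult_def vec_eq_iff mult.commute)

lemma conj_transpose_conj_transpose [simp]: "conj_transpose (conj_transpose M) = M"
  by (simp add: conj_transpose_def vec_eq_iff)

lemma conj_transpose_mat: "conj_transpose (mat c) = mat (cnj c)"
  by (auto simp: conj_transpose_def mat_def vec_eq_iff)

lemma det_conj_transpose: "det (conj_transpose M) = cnj (det M)"
proof -
  have "det (conj_transpose M) = det (transpose (\<chi> i j. cnj (M $ i $ j)))"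
    by (simp add: conj_transpose_def transpose_def)
  also have "\<dots> = det (\<chi> i j. cnj (M $ i $ j))"
    by (rule det_transpose)
  also have "\<dots> = cnj (det M)"
    by (simp add: det_def)
  finally show ?thesis .
qed

lemma mat_mult_commute:
  fixes M :: "complex^'n^'n"
  shows "mat c ** M = M ** mat c"
  by (simp add: matrix_matrix_mult_def mat_def vec_eq_iff mult_delta_left mult_delta_right
      mult.commute)

lemma mat_mult_mat: "mat c ** mat d = (mat (c * d) :: complex^'n^'n)"
  by (simp add: matrix_matrix_mult_def mat_def vec_eq_iff mult_delta_left)

lemma det_mat: "det (mat c :: complex^'n^'n) = c ^ CARD('n)"
  by (subst det_diagonal) (auto simp: mat_def)

lemma unitary_mult:
  assumes "unitary X" "unitary Y" shows "unitary (X ** Y)"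
proof -
  have "X ** Y ** conj_transpose (X ** Y) = X ** (Y ** conj_transpose Y) ** conj_transpose X"
    and "conj_transpose (X ** Y) ** (X ** Y) = conj_transpose Y ** (conj_transpose X ** X) ** Y"
    by (simp_all only: conj_transpose_mult matrix_mul_assoc)
  then show ?thesis using assms by (simp add: unitary_def)
qed

lemma unitary_conj_transpose: "unitary X \<Longrightarrow> unitary (conj_transpose X)"
  by (simp add: unitary_def)

lemma conj_transpose_similarity:
  assumes "unitary U"
  shows "U ** (conj_transpose U ** M ** U) ** conj_transpose U = M"
proof -
  have "U ** (conj_transpose U ** M ** U) ** conj_transpose U
      = (U ** conj_transpose U) ** M ** (U ** conj_transpose U)"
    by (simp only: matrix_mul_assoc)
  then show ?thesis using assms by (simp add: unitary_def)
qed

text \<open>Take determinants in \<open>X ** conj_transpose X = mat 1\<close>; the adjoint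
  contributes the conjugate of \<open>det X\<close>.\<close>

lemma cmod_det_unitary:
  assumes "unitary X" shows "cmod (det X) = 1"
proof -
  have "det X * cnj (det X) = det (X ** conj_transpose X)"
    by (simp only: det_mul det_conj_transpose)
  also have "\<dots> = 1" using assms by (simp add: unitary_def)
  finally have "complex_of_real ((cmod (det X))\<^sup>2) = 1"
    by (simp add: complex_norm_square del: of_real_power)
  then have "(cmod (det X))\<^sup>2 = 1" using of_real_eq_1_iff by blast
  then show ?thesis by (simp add: abs_square_eq_1)
qed

section \<open>Normalizing the determinant by a global phase\<close>

lemma unitary_special_unitary_phase:
  fixes X :: "complex^'n^'n"
  assumes "unitary X"
  obtains c where "cmod c = 1" "mat c ** X \<in> special_unitary"
proof -
  \<comment> \<open>With n the matrix size, \<open>mat c\<close> multiplies the determinant by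
    \<open>c ^ n\<close>, so \<open>c\<close> is chosen as an n-th root of the inverse of
    \<open>det X\<close>, which has modulus 1.\<close>
  define c where "c = cis (- Arg (det X) / CARD('n))"
  have c: "cmod c = 1" by (simp add: c_def)
  have cc: "c * cnj c = 1" using c by (simp add: complex_norm_square[symmetric])
  have "unitary (mat c :: complex^'n^'n)"
    using cc by (simp add: unitary_def conj_transpose_mat mat_mult_mat mult.commute)
  then have u: "unitary (mat c ** X)" using assms by (rule unitary_mult)
  have "det X = cis (Arg (det X))"
    using cmod_det_unitary[OF assms] rcis_cmod_Arg[of "det X"] by (simp add: rcis_def)
  moreover have "c ^ CARD('n) = cis (- Arg (det X))"
    by (simp add: c_def Complex.DeMoivre)
  ultimately have "det (mat c ** X) = 1"
    by (metis det_mul det_mat cis_mult add.left_inverse cis_zero)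
  with u c show thesis by (intro that) (auto simp: special_unitary_def)
qed

text \<open>The scalar matrices \<open>mat c\<close> and \<open>mat (cnj c)\<close> commute past the
  other factors and cancel each other. Hence correcting the determinant by a phase does not change
  the evolved state.\<close>

lemma phase_conj:
  fixes X M :: "complex^'n^'n"
  assumes "cmod c = 1"
  shows "mat c ** X ** M ** conj_transpose (mat c ** X) = X ** M ** conj_transpose X"
proof -
  have cc: "c * cnj c = 1" using assms by (simp add: complex_norm_square[symmetric])
  have "mat c ** X ** M ** conj_transpose (mat c ** X)
      = mat c ** (X ** M ** conj_transpose X) ** mat (cnj c)"
    by (simp add: conj_transpose_mult conj_transpose_mat matrix_mul_assoc)
  also have "\<dots> = X ** M ** conj_transpose X ** (mat c ** mat (cnj c))"
    by (subst mat_mult_commute) (simp only: matrix_mul_assoc)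
  finally show ?thesis by (simp add: mat_mult_mat cc)
qed

section \<open>Tensor products and the partial trace\<close>

lemma kron_mult: "kron P Q ** kron P' Q' = kron (P ** P') (Q ** Q')"
  by (simp add: kron_def matrix_matrix_mult_def vec_eq_iff sum_product sum.cartesian_product
      case_prod_unfold mult_ac)

lemma conj_transpose_kron: "conj_transpose (kron P Q) = kron (conj_transpose P) (conj_transpose Q)"
  by (simp add: kron_def conj_transpose_def vec_eq_iff)

lemma kron_mat_1: "kron (mat 1) (mat 1) = mat 1"
  by (auto simp: kron_def mat_def vec_eq_iff prod_eq_iff)

lemma unitary_kron: "unitary P \<Longrightarrow> unitary Q \<Longrightarrow> unitary (kron P Q)"
  by (simp add: unitary_def conj_transpose_kron kron_mult kron_mat_1)

lemma unitary_mat_1: "unitary (mat 1)"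
  by (simp add: unitary_def conj_transpose_mat)

text \<open>The identity on the second factor leaves the traced index alone, so the sum over it can
  be taken before or after the multiplications by \<open>U\<close>. A change of basis on S can thus
  be carried out after the partial trace.\<close>

lemma partial_trace_A_kron_conj:
  fixes M :: "complex^('s::finite \<times> 'a::finite)^('s \<times> 'a)"
  shows "partial_trace_A (kron U (mat 1) ** M ** conj_transpose (kron U (mat 1)))
    = U ** partial_trace_A M ** conj_transpose U"
proof -
  have L: "(kron U (mat 1) ** N) $ (i, k) $ y = (\<Sum>j\<in>UNIV. U $ i $ j * N $ (j, k) $ y)"
    for N :: "complex^('s \<times> 'a)^('s \<times> 'a)" and i k y
    by (simp add: matrix_matrix_mult_def kron_def mat_def UNIV_Times_UNIV[symmetric]
        sum.cartesian_product' if_distrib if_distribR cong: if_cong del: UNIV_Times_UNIV)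
  have R: "(N ** conj_transpose (kron U (mat 1))) $ y $ (i, k)
      = (\<Sum>j\<in>UNIV. N $ y $ (j, k) * cnj (U $ i $ j))"
    for N :: "complex^('s \<times> 'a)^('s \<times> 'a)" and i k y
    by (simp add: matrix_matrix_mult_def kron_def conj_transpose_def mat_def
        UNIV_Times_UNIV[symmetric] sum.cartesian_product' if_distrib if_distribR
        cong: if_cong del: UNIV_Times_UNIV)
  have "partial_trace_A (kron U (mat 1) ** M ** conj_transpose (kron U (mat 1))) $ i $ j
      = (U ** partial_trace_A M ** conj_transpose U) $ i $ j" for i j
  proof -
    have "partial_trace_A (kron U (mat 1) ** M ** conj_transpose (kron U (mat 1))) $ i $ j
        = (\<Sum>k\<in>UNIV. \<Sum>l\<in>UNIV. \<Sum>m\<in>UNIV. U $ i $ m * M $ (m, k) $ (l, k) * cnj (U $ j $ l))"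
      by (simp add: partial_trace_A_def R L sum_distrib_right)
    also have "\<dots> = (\<Sum>l\<in>UNIV. \<Sum>m\<in>UNIV. \<Sum>k\<in>UNIV. U $ i $ m * M $ (m, k) $ (l, k) * cnj (U $ j $ l))"
      by (subst sum.swap) (intro sum.cong refl sum.swap)
    also have "\<dots> = (U ** partial_trace_A M ** conj_transpose U) $ i $ j"
      by (simp add: matrix_matrix_mult_def partial_trace_A_def conj_transpose_def
          sum_distrib_left sum_distrib_right)
    finally show ?thesis .
  qed
  then show ?thesis by (simp add: vec_eq_iff)
qed

section \<open>Operations that preserve density matrices\<close>

text \<open>The adjoint relation of the standard Hermitian inner product, written in the form in
  which \<open>pos_semidef\<close> states the quadratic form.\<close>

lemma sum_cnj_matrix_vector:
  fixes X :: "complex^'n^'m"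
  shows "(\<Sum>i\<in>UNIV. cnj (v $ i) * (X *v u) $ i)
    = (\<Sum>j\<in>UNIV. cnj ((conj_transpose X *v v) $ j) * u $ j)"
proof -
  have "(\<Sum>i\<in>UNIV. cnj (v $ i) * (X *v u) $ i) = (\<Sum>i\<in>UNIV. \<Sum>j\<in>UNIV. cnj (v $ i) * X $ i $ j * u $ j)"
    by (simp add: matrix_vector_mult_def sum_distrib_left mult.assoc)
  also have "\<dots> = (\<Sum>j\<in>UNIV. \<Sum>i\<in>UNIV. cnj (v $ i) * X $ i $ j * u $ j)"
    by (rule sum.swap)
  also have "\<dots> = (\<Sum>j\<in>UNIV. cnj ((conj_transpose X *v v) $ j) * u $ j)"
    by (simp add: matrix_vector_mult_def conj_transpose_def sum_distrib_left sum_distrib_right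
        mult_ac)
  finally show ?thesis .
qed

text \<open>The quadratic form of the conjugated matrix at \<open>v\<close> is that of
  \<open>M\<close> at \<open>conj_transpose X *v v\<close>.\<close>

lemma pos_semidef_conj:
  fixes X :: "complex^'n^'m"
  assumes "pos_semidef M"
  shows "pos_semidef (X ** M ** conj_transpose X)"
proof -
  have "0 \<le> Re (\<Sum>i\<in>UNIV. cnj (v $ i) * ((X ** M ** conj_transpose X) *v v) $ i)" for v
  proof -
    have "(X ** M ** conj_transpose X) *v v = X *v (M *v (conj_transpose X *v v))"
      by (simp add: matrix_vector_mul_assoc matrix_mul_assoc)
    then show ?thesis
      using assms by (simp add: sum_cnj_matrix_vector[of v X] pos_semidef_def)
  qed
  moreover have "hermitian (X ** M ** conj_transpose X)"
    using assms by (simp add: pos_semidef_def hermitian_def conj_transpose_mult matrix_mul_assoc)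
  ultimately show ?thesis by (simp add: pos_semidef_def)
qed

lemma trace_mult_commute:
  fixes M :: "complex^'n^'m" and N :: "complex^'m^'n"
  shows "trace (M ** N) = trace (N ** M)"
  unfolding trace_def matrix_matrix_mult_def
  by (simp add: mult.commute) (rule sum.swap)

text \<open>Cyclicity of the trace brings \<open>conj_transpose X ** X\<close> together. As
  \<open>X\<close> may be rectangular, this covers both unitary evolutions and embeddings of S into
  S+A.\<close>

lemma density_matrix_isometry_conj:
  fixes X :: "complex^'n^'m"
  assumes "density_matrix \<rho>" "conj_transpose X ** X = mat 1"
  shows "density_matrix (X ** \<rho> ** conj_transpose X)"
proof -
  have "trace (X ** \<rho> ** conj_transpose X) = trace (conj_transpose X ** X ** \<rho>)"
    by (metis trace_mult_commute matrix_mul_assoc)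
  then show ?thesis
    using assms by (simp add: density_matrix_def pos_semidef_conj)
qed

text \<open>Since \<open>\<sigma>\<close> is the outer product of a unit vector
  \<open>\<psi>\<close>, the tensor product is the conjugate of \<open>\<rho>\<close> by an
  isometry.\<close>

lemma density_matrix_kron_pure:
  fixes \<rho> :: "complex^('s::finite)^'s" and \<sigma> :: "complex^('a::finite)^'a"
  assumes "density_matrix \<rho>" "pure_state \<sigma>"
  shows "density_matrix (kron \<rho> \<sigma>)"
proof -
  obtain \<psi> where n: "norm \<psi> = 1" and \<sigma>: "\<sigma> = (\<chi> i j. \<psi> $ i * cnj (\<psi> $ j))"
    using assms(2) pure_state_iff_outer_product by blast
  \<comment> \<open>\<open>W\<close> is the isometry that appends \<open>\<psi>\<close> as second factor.\<close>
  define W :: "complex^'s^('s \<times> 'a)"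
    where "W = (\<chi> x j. if fst x = j then \<psi> $ snd x else 0)"
  have "(\<Sum>i\<in>UNIV. (cmod (\<psi> $ i))\<^sup>2) = 1" using n by (simp add: norm_vec_def L2_set_def)
  from arg_cong[OF this, of complex_of_real] have s: "(\<Sum>i\<in>UNIV. cnj (\<psi> $ i) * \<psi> $ i) = 1"
    by (simp add: complex_norm_square mult.commute del: of_real_power)
  have "(conj_transpose W ** W) $ i $ j = mat 1 $ i $ j" for i j
  proof -
    have "(conj_transpose W ** W) $ i $ j
        = (\<Sum>x\<in>UNIV. \<Sum>k\<in>UNIV. if x = i then (if i = j then cnj (\<psi> $ k) * \<psi> $ k else 0) else 0)"
      by (simp add: conj_transpose_def W_def matrix_matrix_mult_def UNIV_Times_UNIV[symmetric]
          sum.cartesian_product' del: UNIV_Times_UNIV)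
        (intro sum.cong refl, auto)
    also have "\<dots> = (\<Sum>k\<in>UNIV. if i = j then cnj (\<psi> $ k) * \<psi> $ k else 0)"
      by (subst sum.swap) simp
    also have "\<dots> = mat 1 $ i $ j" by (simp add: mat_def s)
    finally show ?thesis .
  qed
  then have "conj_transpose W ** W = mat 1" by (simp add: vec_eq_iff)
  moreover have "kron \<rho> \<sigma> = W ** \<rho> ** conj_transpose W"
    by (simp add: kron_def \<sigma> W_def matrix_matrix_mult_def conj_transpose_def vec_eq_iff
        if_distrib if_distribR mult_ac cong: if_cong)
  ultimately show ?thesis using density_matrix_isometry_conj assms(1) by metis
qed

text \<open>The quadratic form of the partial trace at \<open>v\<close> is the sum over k of the
  form of \<open>M\<close> at \<open>v\<close> tensored with the k-th basis vector of A; that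
  product vector is \<open>w k\<close> below.\<close>

lemma density_matrix_partial_trace_A:
  fixes M :: "complex^('s::finite \<times> 'a::finite)^('s \<times> 'a)"
  assumes "density_matrix M"
  shows "density_matrix (partial_trace_A M)"
proof -
  have herm: "hermitian (partial_trace_A M)"
    using assms
    by (simp add: density_matrix_def pos_semidef_def hermitian_def conj_transpose_def
        partial_trace_A_def vec_eq_iff)
  have tr: "trace (partial_trace_A M) = trace M"
    by (simp add: trace_def partial_trace_A_def UNIV_Times_UNIV[symmetric]
          sum.cartesian_product' del: UNIV_Times_UNIV)
  have "0 \<le> Re (\<Sum>i\<in>UNIV. cnj (v $ i) * (partial_trace_A M *v v) $ i)" for v
  proof -
    define w :: "'a \<Rightarrow> complex^('s \<times> 'a)" where "w k = (\<chi> x. if snd x = k then v $ fst x else 0)" for k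
    have w: "(\<Sum>x\<in>UNIV. cnj (w k $ x) * (M *v w k) $ x)
        = (\<Sum>i\<in>UNIV. \<Sum>j\<in>UNIV. cnj (v $ i) * (M $ (i, k) $ (j, k) * v $ j))" for k
      by (simp add: w_def matrix_vector_mult_def UNIV_Times_UNIV[symmetric]
          sum.cartesian_product' if_distrib if_distribR sum_distrib_left
          cong: if_cong del: UNIV_Times_UNIV)
    have "(\<Sum>i\<in>UNIV. cnj (v $ i) * (partial_trace_A M *v v) $ i)
        = (\<Sum>i\<in>UNIV. \<Sum>j\<in>UNIV. \<Sum>k\<in>UNIV. cnj (v $ i) * (M $ (i, k) $ (j, k) * v $ j))"
      by (simp add: matrix_vector_mult_def partial_trace_A_def sum_distrib_left sum_distrib_right)
    also have "\<dots> = (\<Sum>i\<in>UNIV. \<Sum>k\<in>UNIV. \<Sum>j\<in>UNIV. cnj (v $ i) * (M $ (i, k) $ (j, k) * v $ j))"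
      by (intro sum.cong refl sum.swap)
    also have "\<dots> = (\<Sum>k\<in>UNIV. \<Sum>x\<in>UNIV. cnj (w k $ x) * (M *v w k) $ x)"
      unfolding w by (rule sum.swap)
    also have "Re \<dots> = (\<Sum>k\<in>UNIV. Re (\<Sum>x\<in>UNIV. cnj (w k $ x) * (M *v w k) $ x))"
      by (rule Re_sum)
    also have "0 \<le> \<dots>"
      using assms unfolding density_matrix_def pos_semidef_def by (intro sum_nonneg) blast
    finally show ?thesis .
  qed
  with herm tr assms show ?thesis by (simp add: density_matrix_def pos_semidef_def)
qed

section \<open>Diagonalization of qubit states\<close>

lemma eigenvector_2:
  fixes M :: "complex^2^2"
  obtains v :: "complex^2" and l where "v \<noteq> 0" "M *v v = l *s v"
proof (cases "M $ 2 $ 1 = 0")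
  case True
  have "M *v axis 1 1 = M $ 1 $ 1 *s axis 1 1"
    using True by (simp add: vec_eq_iff forall_2 matrix_vector_mult_def sum_2 axis_def)
  then show thesis by (intro that[of "axis 1 1"]) auto
next
  case False
  \<comment> \<open>The radicand is the discriminant of the characteristic polynomial, so
    \<open>l\<close> is one of its roots.\<close>
  define s where "s = csqrt ((M $ 1 $ 1 - M $ 2 $ 2)\<^sup>2 + 4 * M $ 1 $ 2 * M $ 2 $ 1)"
  define l where "l = (M $ 1 $ 1 + M $ 2 $ 2 + s) / 2"
  have "s\<^sup>2 = (M $ 1 $ 1 - M $ 2 $ 2)\<^sup>2 + 4 * M $ 1 $ 2 * M $ 2 $ 1" by (simp add: s_def)
  then have root: "(l - M $ 1 $ 1) * (l - M $ 2 $ 2) = M $ 1 $ 2 * M $ 2 $ 1"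
    by (simp add: l_def field_simps power2_eq_square)
  \<comment> \<open>The second row of the eigenvector equation holds identically for this vector;
    the first row is \<open>root\<close>.\<close>
  define v :: "complex^2" where "v = vector [l - M $ 2 $ 2, M $ 2 $ 1]"
  have "M *v v = l *s v"
    using root
    by (simp add: v_def vec_eq_iff forall_2 matrix_vector_mult_def sum_2 algebra_simps)
  moreover have "v \<noteq> 0" using False by (auto simp: v_def vec_eq_iff forall_2)
  ultimately show thesis by (rule that[rotated])
qed

lemma density_matrix_2_diagonalize:
  fixes \<rho> :: "complex^2^2"
  assumes "density_matrix \<rho>"
  obtains U q where "unitary U" "0 \<le> q" "q \<le> 1"
    "\<rho> = U ** vector [vector [of_real q, 0], vector [0, of_real (1 - q)]] ** conj_transpose U"
proof -
  obtain v0 :: "complex^2" and l where v0: "v0 \<noteq> 0" "\<rho> *v v0 = l *s v0"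
    by (rule eigenvector_2)
  define v where "v = of_real (1 / norm v0) *s v0"
  have ev: "\<rho> *v v = l *s v"
    using v0(2) by (simp add: v_def vector_scalar_commute vec_eq_iff)
  have "v = (1 / norm v0) *\<^sub>R v0" by (simp add: v_def vec_eq_iff scaleR_conv_of_real[where 'a=complex])
  then have "norm v = 1" using v0(1) by simp
  then have "(cmod (v $ 1))\<^sup>2 + (cmod (v $ 2))\<^sup>2 = 1"
    by (simp add: norm_vec_def L2_set_def sum_2)
  from arg_cong[OF this, of complex_of_real]
  have n: "v $ 1 * cnj (v $ 1) + v $ 2 * cnj (v $ 2) = 1"
    by (simp add: complex_norm_square del: of_real_power)
  \<comment> \<open>The first column is \<open>v\<close>; the second is a unit vector orthogonal to
    it.\<close>
  define U :: "complex^2^2"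
    where "U = vector [vector [v $ 1, - cnj (v $ 2)], vector [v $ 2, cnj (v $ 1)]]"
  have U: "unitary U"
    using n by (simp add: unitary_def U_def conj_transpose_def matrix_matrix_mult_def mat_def
        vec_eq_iff forall_2 sum_2 mult.commute add.commute)
  define N where "N = conj_transpose U ** \<rho> ** U"
  have "density_matrix N"
    using density_matrix_isometry_conj[OF assms, of "conj_transpose U"] U
    by (simp add: N_def unitary_def)
  then have psd: "\<And>w. 0 \<le> Re (\<Sum>i\<in>UNIV. cnj (w $ i) * (N *v w) $ i)"
    and herm: "\<And>i j. cnj (N $ j $ i) = N $ i $ j" and tr: "N $ 1 $ 1 + N $ 2 $ 2 = 1"
    by (auto simp: density_matrix_def pos_semidef_def hermitian_def conj_transpose_def
        vec_eq_iff trace_def sum_2)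
  have "(\<rho> ** U) $ i $ 1 = l * v $ i" for i
    using ev exhaust_2[of i]
    by (auto simp: U_def matrix_matrix_mult_def matrix_vector_mult_def vec_eq_iff forall_2 sum_2)
  moreover have "N $ 2 $ 1 = (\<Sum>k\<in>UNIV. conj_transpose U $ 2 $ k * (\<rho> ** U) $ k $ 1)"
    unfolding N_def matrix_mul_assoc[symmetric] by (simp add: matrix_matrix_mult_def)
  \<comment> \<open>This entry is \<open>l\<close> times the inner product of the two orthogonal
    columns of \<open>U\<close>. Hermiticity then removes the other off-diagonal entry.\<close>
  ultimately have "N $ 2 $ 1 = 0"
    by (simp add: sum_2 U_def conj_transpose_def)
  moreover from this have "N $ 1 $ 2 = 0" using herm[of 1 2] by simp
  moreover define q where "q = Re (N $ 1 $ 1)"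
  moreover have "N $ 1 $ 1 = of_real q" using herm[of 1 1] by (simp add: q_def complex_eq_iff)
  moreover from this have "N $ 2 $ 2 = of_real (1 - q)" using tr by (simp add: algebra_simps)
  ultimately have N: "N = vector [vector [of_real q, 0], vector [0, of_real (1 - q)]]"
    by (simp add: vec_eq_iff forall_2)
  have "0 \<le> q" "0 \<le> 1 - q"
    using psd[of "axis 1 1"] psd[of "axis 2 1"]
    by (simp_all add: N sum_2 matrix_vector_mult_def axis_def)
  moreover have "\<rho> = U ** N ** conj_transpose U"
    unfolding N_def using conj_transpose_similarity[OF U] by simp
  ultimately show thesis using U N that by auto
qed

section \<open>The entangling rotation\<close>

text \<open>
  Columns (1, \<open>_\<close>) live on the span of |11> and |22>, columns (2, \<open>_\<close>) on the span of
  |12> and |21>; the second index selects the column (a, b) or (-b, a) of a plane rotation.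
\<close>
definition schmidt_rotation :: "real \<Rightarrow> real \<Rightarrow> complex^(2 \<times> 2)^(2 \<times> 2)" where
  "schmidt_rotation a b = (\<chi> x y.
     if (fst x = snd x) = (fst y = 1)
     then of_real (if fst x = 1 then (if snd y = 1 then a else - b) else (if snd y = 1 then b else a))
     else 0)"

lemma sum_2_times_2: "(\<Sum>x\<in>UNIV. f x) = f (1, 1) + f (1, 2) + f (2, 1) + f (2::2, 2::2)"
  by (simp add: UNIV_Times_UNIV[symmetric] sum.cartesian_product' sum_2 add.assoc
      del: UNIV_Times_UNIV)

lemma forall_2_times_2: "(\<forall>x. P x) \<longleftrightarrow> P (1, 1) \<and> P (1, 2) \<and> P (2, 1) \<and> P (2::2, 2::2)"
  by (simp add: split_paired_All forall_2)

text \<open>Up to reordering the basis, the matrix is a direct sum of two copies of the same plane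
  rotation.\<close>

lemma unitary_schmidt_rotation:
  assumes "a * a + b * b = 1"
  shows "unitary (schmidt_rotation a b)"
proof -
  have 1: "complex_of_real a * of_real a + of_real b * of_real b = 1"
    using assms by (metis of_real_1 of_real_add of_real_mult)
  then have 2: "complex_of_real b * of_real b + of_real a * of_real a = 1"
    by (simp only: add.commute)
  show ?thesis
    unfolding unitary_def vec_eq_iff forall_2_times_2
    by (simp add: 1 2 schmidt_rotation_def conj_transpose_def matrix_matrix_mult_def mat_def
        sum_2_times_2)
qed

text \<open>The weights \<open>d\<close> and \<open>1 - d\<close> fall on columns (1, 1) and (2, 1),
  that is, on a |11> + b |22> and a |12> + b |21>. Their reduced matrices coincide, so the weights
  add up to 1 and \<open>d\<close> disappears.\<close>

lemma partial_trace_A_schmidt_rotation: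
  fixes d :: complex
  shows "partial_trace_A (schmidt_rotation a b **
      kron (vector [vector [d, 0], vector [0, 1 - d]]) (vector [vector [1, 0], vector [0, 0]]) **
      conj_transpose (schmidt_rotation a b))
    = vector [vector [of_real (a * a), 0], vector [0, of_real (b * b)]]"
  unfolding vec_eq_iff forall_2 partial_trace_A_def sum_2
  by (simp add: kron_def schmidt_rotation_def conj_transpose_def matrix_matrix_mult_def
      sum_2_times_2)
    (simp add: algebra_simps)
lemma pure_state_ground:
  "pure_state (vector [vector [1, 0], vector [0, 0]] :: complex^2^2)"
  unfolding pure_state_iff_outer_product
  by (intro exI[of _ "axis 1 1"])
    (simp add: vec_eq_iff forall_2 axis_def norm_vec_def L2_set_def sum_2)

section \<open>Reachability and full indirect controllability\<close>

lemma special_unitary_reaches: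
  fixes \<rho> \<rho>' :: "complex^2^2"
  assumes "density_matrix \<rho>" "density_matrix \<rho>'"
  obtains \<sigma> :: "complex^2^2" and X where "pure_state \<sigma>" "X \<in> special_unitary"
    "partial_trace_A (X ** kron \<rho> \<sigma> ** conj_transpose X) = \<rho>'"
proof -
  let ?D = "\<lambda>q. vector [vector [of_real q, 0], vector [0, of_real (1 - q)]] :: complex^2^2"
  let ?E = "vector [vector [1, 0], vector [0, 0]] :: complex^2^2"
  obtain U p where U: "unitary U" and \<rho>: "\<rho> = U ** ?D p ** conj_transpose U"
    using density_matrix_2_diagonalize[OF assms(1)] by metis
  obtain U' q where U': "unitary U'" and q: "0 \<le> q" "q \<le> 1"
    and \<rho>': "\<rho>' = U' ** ?D q ** conj_transpose U'"
    using density_matrix_2_diagonalize[OF assms(2)] by metis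
  \<comment> \<open>\<open>K\<close> carries the source state to its diagonal form, \<open>V\<close>
    replaces the spectrum by that of the target, and \<open>K'\<close> rotates to the eigenbasis of
    the target.\<close>
  define K where "K = kron (conj_transpose U) (mat 1 :: complex^2^2)"
  define K' where "K' = kron U' (mat 1 :: complex^2^2)"
  define V where "V = schmidt_rotation (sqrt q) (sqrt (1 - q))"
  have "unitary (K' ** V ** K)"
    using U U' q unfolding K_def K'_def V_def
    by (intro unitary_mult unitary_kron unitary_conj_transpose unitary_mat_1
        unitary_schmidt_rotation) simp_all
  then obtain c where c: "cmod c = 1" "mat c ** (K' ** V ** K) \<in> special_unitary"
    by (rule unitary_special_unitary_phase)
  have "conj_transpose U ** \<rho> ** U = ?D p"
    using conj_transpose_similarity[OF unitary_conj_transpose[OF U], of "?D p"]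
    by (simp only: conj_transpose_conj_transpose flip: \<rho>)
  then have K: "K ** kron \<rho> ?E ** conj_transpose K = kron (?D p) ?E"
    by (simp add: K_def conj_transpose_kron kron_mult conj_transpose_mat)
  have "K' ** V ** K ** kron \<rho> ?E ** conj_transpose (K' ** V ** K)
      = K' ** (V ** (K ** kron \<rho> ?E ** conj_transpose K) ** conj_transpose V) ** conj_transpose K'"
    by (simp add: conj_transpose_mult matrix_mul_assoc)
  \<comment> \<open>From here the chain concerns partial traces: the preceding equation is
    substituted under \<open>partial_trace_A\<close>.\<close>
  also have "partial_trace_A \<dots>
      = U' ** partial_trace_A (V ** kron (?D p) ?E ** conj_transpose V) ** conj_transpose U'"
    unfolding K unfolding K'_def by (rule partial_trace_A_kron_conj)
  also have "\<dots> = \<rho>'"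
    using partial_trace_A_schmidt_rotation[of "sqrt q" "sqrt (1 - q)" "of_real p"] q
    by (simp add: V_def \<rho>' del: of_real_mult)
  finally show thesis
    using c by (intro that[OF pure_state_ground c(2)]) (simp only: phase_conj)
qed

theorem theorem5:
  fixes R :: "(complex^(2 \<times> 2)^(2 \<times> 2)) set"
  assumes "\<And>X. X \<in> R \<Longrightarrow> unitary X"
    and "completely_controllable R"
  shows "pure_fully_indirectly_controllable R \<and>
    (\<forall>\<rho>\<^sub>S \<rho>\<^sub>S'. density_matrix \<rho>\<^sub>S \<longrightarrow> density_matrix \<rho>\<^sub>S' \<longrightarrow>
      (\<exists>\<rho>\<^sub>A X. pure_state \<rho>\<^sub>A \<and> X \<in> R \<and> X \<in> special_unitary \<and>
        partial_trace_A (X ** kron \<rho>\<^sub>S \<rho>\<^sub>A ** conj_transpose X) = \<rho>\<^sub>S'))"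
proof -
  have reach: "\<exists>\<rho>\<^sub>A X. pure_state \<rho>\<^sub>A \<and> X \<in> R \<and> X \<in> special_unitary \<and>
      partial_trace_A (X ** kron \<rho>\<^sub>S \<rho>\<^sub>A ** conj_transpose X) = \<rho>\<^sub>S'"
    if "density_matrix \<rho>\<^sub>S" "density_matrix \<rho>\<^sub>S'" for \<rho>\<^sub>S \<rho>\<^sub>S' :: "complex^2^2"
    using special_unitary_reaches[OF that] assms(2) unfolding completely_controllable_def
    by (metis subsetD)
  \<comment> \<open>This gives the inclusion of the reachable set in the density matrices;
    \<open>reach\<close> gives the opposite one.\<close>
  have "density_matrix (partial_trace_A (X ** kron \<rho>\<^sub>S \<rho>\<^sub>A ** conj_transpose X))"
    if "density_matrix \<rho>\<^sub>S" "pure_state \<rho>\<^sub>A" "X \<in> R" for \<rho>\<^sub>S \<rho>\<^sub>A :: "complex^2^2" and X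
    using assms(1)[OF that(3)] that(1,2)
    by (intro density_matrix_partial_trace_A density_matrix_isometry_conj density_matrix_kron_pure)
      (auto simp: unitary_def)
  then have "reachable_set R {\<rho>\<^sub>A. pure_state \<rho>\<^sub>A} \<rho>\<^sub>S = {\<rho>. density_matrix \<rho>}"
    if "density_matrix \<rho>\<^sub>S" for \<rho>\<^sub>S :: "complex^2^2"
    using that reach[OF that] unfolding reachable_set_def by blast
  with reach show ?thesis
    unfolding pure_fully_indirectly_controllable_def fully_indirectly_controllable_def by blast
qed

end
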